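(* Let $(f_j)_{j\ge 1}$ and $(g_j)_{j\ge 1}$ be sequences of real numbers with $f_j>0$ and $g_j>0$ for all $j$, and let $F_n:=\sum_{j=1}^n f_j$ and $G_n:=\sum_{j=1}^n g_j$. Let $L$ be a real number. Assume that $$\lim_{n\to\infty}F_n=\lim_{n\to\infty}G_n=\infty$$ and $$\lim_{n\to\infty}\frac{f_n}{g_n}=L.$$ Then $$\lim_{n\to\infty}\frac{F_n}{G_n}=L.$$ *)

theory Defs
  imports Complex_Main
begin

end

theory Submission
  imports Defs
begin

text \<open>
  This is the Stolz--Cesaro theorem for partial sums. The reason it holds is that a divergent
  denominator forgets any finite part of the numerator: writing \<open>f j = L * g j + h j\<close>, the error
  \<open>h\<close> is negligible against \<open>g\<close>, so after some index its sum grows by at most a small multiple of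
  the growth of \<open>G n\<close>, and the constant accumulated before that index vanishes after division by
  \<open>G n\<close>. The lemma \<open>sum_ratio_tendsto_0\<close> carries this argument; the theorem
  follows by adding \<open>L\<close> back.
\<close>

text \<open>
  The split index \<open>N\<close> separates the terms where \<open>h\<close> is uncontrolled from those where it is
  dominated by a multiple of \<open>g\<close>. Only the divergence of the denominator can absorb the former,
  so it is kept as a separate constant.
\<close>
lemma abs_sum_le_tail_dominated:
  fixes g h :: "nat \<Rightarrow> real"
  assumes g_pos: "\<And>j. j \<ge> 1 \<Longrightarrow> g j > 0"
    and dominated: "\<And>j. j \<ge> N \<Longrightarrow> \<bar>h j\<bar> \<le> c * g j"
    and "c \<ge> 0" and "N \<le> n"
  shows "\<bar>\<Sum>j=1..n. h j\<bar> \<le> \<bar>\<Sum>j=1..N. h j\<bar> + c * (\<Sum>j=1..n. g j)"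
  using \<open>N \<le> n\<close>
proof (induction n rule: dec_induct)
  case base
  have "(\<Sum>j=1..N. g j) \<ge> 0"
    using g_pos by (intro sum_nonneg) (auto intro: less_imp_le)
  then show ?case
    using \<open>c \<ge> 0\<close> by simp
next
  case (step n)
  have "\<bar>h (Suc n)\<bar> \<le> c * g (Suc n)"
    using dominated step.hyps by simp
  then show ?case
    using step.IH by (simp add: algebra_simps)
qed

text \<open>
  The case of limit zero. Half of the tolerance is spent on the dominated tail, the other half on
  the constant left by the initial terms.
\<close>
lemma sum_ratio_tendsto_0:
  fixes g h :: "nat \<Rightarrow> real"
  assumes g_pos: "\<And>j. j \<ge> 1 \<Longrightarrow> g j > 0"
    and G_lim: "filterlim (\<lambda>n. \<Sum>j=1..n. g j) at_top sequentially"
    and ratio_lim: "(\<lambda>n. h n / g n) \<longlonglongrightarrow> 0"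
  shows "(\<lambda>n. (\<Sum>j=1..n. h j) / (\<Sum>j=1..n. g j)) \<longlonglongrightarrow> 0"
proof (rule tendstoI)
  fix e :: real
  assume "e > 0"
  then have "\<forall>\<^sub>F n in sequentially. \<bar>h n / g n\<bar> < e / 2"
    using tendstoD[OF ratio_lim, of "e / 2"] by simp
  then obtain M where M: "\<And>n. n \<ge> M \<Longrightarrow> \<bar>h n / g n\<bar> < e / 2"
    by (auto simp: eventually_sequentially)
  (* The sign of g 0 is unknown, so the tail must start at a positive index. *)
  define N where "N = max M 1"
  have dominated: "\<bar>h j\<bar> \<le> e / 2 * g j" if "j \<ge> N" for j
  proof -
    have "g j > 0" and "\<bar>h j / g j\<bar> < e / 2"
      using that g_pos M by (auto simp: N_def)
    then show ?thesis
      by (simp add: abs_divide field_simps)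
  qed
  define C where "C = \<bar>\<Sum>j=1..N. h j\<bar>"
  have "\<forall>\<^sub>F n in sequentially. (\<Sum>j=1..n. g j) > 2 * C / e"
    using G_lim by (simp add: filterlim_at_top_dense)
  then show "\<forall>\<^sub>F n in sequentially. dist ((\<Sum>j=1..n. h j) / (\<Sum>j=1..n. g j)) 0 < e"
    using eventually_ge_at_top[of N]
  proof eventually_elim
    case (elim n)
    let ?G = "\<Sum>j=1..n. g j"
    have "2 * C / e \<ge> 0"
      using \<open>e > 0\<close> by (simp add: C_def)
    then have "?G > 0"
      using elim(1) by linarith
    have "\<bar>\<Sum>j=1..n. h j\<bar> \<le> C + e / 2 * ?G"
      unfolding C_def using abs_sum_le_tail_dominated[OF g_pos dominated] \<open>e > 0\<close> elim(2) by simp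
    moreover have "C < e / 2 * ?G"
      using elim(1) \<open>e > 0\<close> by (simp add: field_simps)
    ultimately have "\<bar>\<Sum>j=1..n. h j\<bar> < e * ?G"
      by simp
    then show ?case
      using \<open>?G > 0\<close> by (simp add: abs_divide field_simps)
  qed
qed

theorem theorem2:
  fixes f g :: "nat \<Rightarrow> real" and L :: real
  assumes f_pos: "\<And>j. j \<ge> 1 \<Longrightarrow> f j > 0"
    and g_pos: "\<And>j. j \<ge> 1 \<Longrightarrow> g j > 0"
    and F_lim: "filterlim (\<lambda>n. \<Sum>j=1..n. f j) at_top sequentially"
    and G_lim: "filterlim (\<lambda>n. \<Sum>j=1..n. g j) at_top sequentially"
    and ratio_lim: "(\<lambda>n. f n / g n) \<longlonglongrightarrow> L"
  shows "(\<lambda>n. (\<Sum>j=1..n. f j) / (\<Sum>j=1..n. g j)) \<longlonglongrightarrow> L"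
proof -
  define h where "h j = f j - L * g j" for j
  have "\<forall>\<^sub>F n in sequentially. f n / g n - L = h n / g n"
    using eventually_ge_at_top[of 1]
  proof eventually_elim
    case (elim n)
    then have "g n > 0"
      by (rule g_pos)
    then show ?case
      by (simp add: h_def field_simps)
  qed
  moreover have "(\<lambda>n. f n / g n - L) \<longlonglongrightarrow> 0"
    using ratio_lim by (rule LIM_zero)
  ultimately have "(\<lambda>n. h n / g n) \<longlonglongrightarrow> 0"
    by (rule Lim_transform_eventually[rotated])
  with g_pos G_lim have "(\<lambda>n. (\<Sum>j=1..n. h j) / (\<Sum>j=1..n. g j)) \<longlonglongrightarrow> 0"
    by (rule sum_ratio_tendsto_0)
  moreover have "\<forall>\<^sub>F n in sequentially. (\<Sum>j=1..n. h j) / (\<Sum>j=1..n. g j)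
      = (\<Sum>j=1..n. f j) / (\<Sum>j=1..n. g j) - L"
  proof -
    have "\<forall>\<^sub>F n in sequentially. (\<Sum>j=1..n. g j) > 0"
      using G_lim by (simp add: filterlim_at_top_dense)
    then show ?thesis
      by eventually_elim
        (simp add: h_def sum_subtractf sum_distrib_left[symmetric] diff_divide_distrib)
  qed
  ultimately have "(\<lambda>n. (\<Sum>j=1..n. f j) / (\<Sum>j=1..n. g j) - L) \<longlonglongrightarrow> 0"
    by (rule Lim_transform_eventually)
  then show ?thesis
    by (rule LIM_zero_cancel)
qed

end
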